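(* Let $A[x,\sigma]$ be a Hopf-Ore extension of a Hopf algebra $A$, with associated grouplike $g\in G(A)$ and character $\chi$, and put $q=\chi(g)\in\Bbbk^\times$. Let $\cdot: A\otimes R\to R$ be a partial action of $A$ on an algebra $R$ such that $g\cdot 1_R=0$, and fix an element $w\in R$. Define a linear map $\cdot: A[x,\sigma]\otimes R\to R$ (extending the given one) by $$x^ja\cdot r=\sum_{k=0}^{j}(-1)^k q^{-\frac{k(k-1)}{2}}\binom{j}{k}_{q^{-1}} w^{j-k}(g^ka\cdot r)w^k\qquad (a\in A,\ r\in R,\ j\in\mathbb{N}_0).$$ Then: (i) $1\cdot r=r$ for all $r\in R$. (ii) $x^ja\cdot(rs)=((x^ja)_1\cdot r)((x^ja)_2\cdot s)$ for all $a\in A$, $j\in\mathbb{N}_0$, $r,s\in R$. (iii) If $a\cdot(x^jb\cdot r)=(a_1\cdot 1_R)(a_2x^jb\cdot r)$ for all $a,b\in A$, $j\in\mathbb{N}_0$, $r\in R$, then $x^ja\cdot(x^ib\cdot r)=((x^ja)_1\cdot 1_R)((x^ja)_2x^ib\cdot r)$ for all $a,b\in A$, $i,j\in\mathbb{N}_0$, $r\in R$. (iv) If $a\cdot(x^jb\cdot r)=(a_1x^jb\cdot r)(a_2\cdot 1_R)$ for all $a,b\in A$, $j\in\mathbb{N}_0$, $r\in R$, then $x^ja\cdot(x^ib\cdot r)=((x^ja)_1x^ib\cdot r)((x^ja)_2\cdot 1_R)$ for all $a,b\in A$, $i,j\in\mathbb{N}_0$, $r\in R$.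
   Context: $\Bbbk$ is an algebraically closed field of characteristic zero; all algebras are associative unital $\Bbbk$-algebras. Sweedler notation $\Delta(h)=h_1\otimes h_2$ is used; $G(A)$ is the group of grouplike elements of $A$. A (left) partial action of a Hopf algebra $\mathcal{H}$ on an algebra $R$ is a linear map $\cdot:\mathcal{H}\otimes R\to R$, $h\otimes r\mapsto h\cdot r$, such that for all $h,k\in\mathcal{H}$, $r,s\in R$: (PA.1) $1_{\mathcal H}\cdot r=r$; (PA.2) $h\cdot (rs)=(h_1\cdot r)(h_2\cdot s)$; (PA.3) $h\cdot(k\cdot r)=(h_1\cdot 1_R)(h_2k\cdot r)$. Hopf-Ore extension: let $A$ be a Hopf algebra, $g\in G(A)$, $\chi:A\to\Bbbk$ a character (algebra map) and $\sigma$ an algebra automorphism of $A$ with $\sigma(a)=\chi(a_1)a_2=ga_1g^{-1}\chi(a_2)$ for all $a\in A$. $A[x,\sigma]$ is the algebra generated by $A$ and a variable $x$ subject to $xa=\sigma(a)x$ for $a\in A$, with the Hopf algebra structure extending that of $A$ such that $\Delta(x)=x\otimes 1+g\otimes x$. Every element is uniquely of the form $\sum_{i\ge0} x^ia_i$ with $a_i\in A$. $q$-binomial coefficients: $\binom{0}{0}_q=1$, $\binom{n}{m}_q=0$ if $m>n$ or $m<0$, and $\binom{n}{m}_q=\binom{n-1}{m}_q+q^{n-m}\binom{n-1}{m-1}_q$ for $n\ge1$, $0\le m\le n$. *)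

theory Defs
  imports "HOL-Computational_Algebra.Computational_Algebra" "HOL-Library.Poly_Mapping"
begin

section \<open>Algebras over a field\<close>

text \<open>
  The sort \<open>{ring, monoid_mult}\<close> is that of associative unital rings; unlike \<open>ring_1\<close>
  it does not exclude the zero ring.
\<close>

locale k_algebra = vector_space scale
  for scale :: "'k::field \<Rightarrow> 'a::{ring,monoid_mult} \<Rightarrow> 'a" +
  assumes scale_mult_left: "scale c a * b = scale c (a * b)"
    and scale_mult_right: "a * scale c b = scale c (a * b)"

definition algebra_hom ::
  "('k::field \<Rightarrow> 'a::{ring,monoid_mult} \<Rightarrow> 'a) \<Rightarrow> ('k \<Rightarrow> 'b::{ring,monoid_mult} \<Rightarrow> 'b)
    \<Rightarrow> ('a \<Rightarrow> 'b) \<Rightarrow> bool" where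
  "algebra_hom sA sB f \<longleftrightarrow>
     Vector_Spaces.linear sA sB f \<and> f 1 = 1 \<and> (\<forall>a b. f (a * b) = f a * f b)"

definition bilinear_map ::
  "('k::field \<Rightarrow> 'a::ab_group_add \<Rightarrow> 'a) \<Rightarrow> ('k \<Rightarrow> 'b::ab_group_add \<Rightarrow> 'b)
    \<Rightarrow> ('k \<Rightarrow> 'c::ab_group_add \<Rightarrow> 'c) \<Rightarrow> ('a \<Rightarrow> 'b \<Rightarrow> 'c) \<Rightarrow> bool" where
  "bilinear_map sA sB sC f \<longleftrightarrow>
     (\<forall>b. Vector_Spaces.linear sA sC (\<lambda>a. f a b)) \<and> (\<forall>a. Vector_Spaces.linear sB sC (f a))"

definition mult_inverse :: "'a::monoid_mult \<Rightarrow> 'a" where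
  "mult_inverse a = (THE b. a * b = 1 \<and> b * a = 1)"


section \<open>Tensor products\<close>

text \<open>
  The tensor product \<open>A \<otimes> B\<close> is the free vector space on \<open>A \<times> B\<close> modulo the span of the
  bilinearity relators. A tensor is represented by a list of pairs, the list
  \<open>[(a\<^sub>1, b\<^sub>1), \<dots>, (a\<^sub>n, b\<^sub>n)]\<close> standing for \<open>a\<^sub>1 \<otimes> b\<^sub>1 + \<dots> + a\<^sub>n \<otimes> b\<^sub>n\<close>; since scalars can be
  absorbed into a factor, every tensor has such a representative. Equality in the tensor product
  is the relation \<open>tensor_eq\<close> between lists. The threefold tensor product is treated in the
  same way.
\<close>

definition free_scale :: "'k::field \<Rightarrow> ('x \<Rightarrow>\<^sub>0 'k) \<Rightarrow> ('x \<Rightarrow>\<^sub>0 'k)" where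
  "free_scale c u = Poly_Mapping.map (\<lambda>d. c * d) u"

definition free_gen :: "'x \<Rightarrow> ('x \<Rightarrow>\<^sub>0 'k::field)" where
  "free_gen p = Poly_Mapping.single p 1"

definition tensor_relators ::
  "('k::field \<Rightarrow> 'a::ab_group_add \<Rightarrow> 'a) \<Rightarrow> ('k \<Rightarrow> 'b::ab_group_add \<Rightarrow> 'b)
    \<Rightarrow> (('a \<times> 'b) \<Rightarrow>\<^sub>0 'k) set" where
  "tensor_relators sA sB =
     {free_gen (a + a', b) - free_gen (a, b) - free_gen (a', b) |a a' b. True} \<union>
     {free_gen (a, b + b') - free_gen (a, b) - free_gen (a, b') |a b b'. True} \<union>
     {free_gen (sA c a, b) - free_scale c (free_gen (a, b)) |c a b. True} \<union>
     {free_gen (a, sB c b) - free_scale c (free_gen (a, b)) |c a b. True}"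

definition tensor_eq ::
  "('k::field \<Rightarrow> 'a::ab_group_add \<Rightarrow> 'a) \<Rightarrow> ('k \<Rightarrow> 'b::ab_group_add \<Rightarrow> 'b)
    \<Rightarrow> ('a \<times> 'b) list \<Rightarrow> ('a \<times> 'b) list \<Rightarrow> bool" where
  "tensor_eq sA sB s t \<longleftrightarrow>
     (\<Sum>p\<leftarrow>s. free_gen p) - (\<Sum>p\<leftarrow>t. free_gen p)
       \<in> module.span free_scale (tensor_relators sA sB)"

definition tensor3_relators ::
  "('k::field \<Rightarrow> 'a::ab_group_add \<Rightarrow> 'a) \<Rightarrow> ('k \<Rightarrow> 'b::ab_group_add \<Rightarrow> 'b)
    \<Rightarrow> ('k \<Rightarrow> 'c::ab_group_add \<Rightarrow> 'c) \<Rightarrow> (('a \<times> 'b \<times> 'c) \<Rightarrow>\<^sub>0 'k) set" where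
  "tensor3_relators sA sB sC =
     {free_gen (a + a', b, c) - free_gen (a, b, c) - free_gen (a', b, c) |a a' b c. True} \<union>
     {free_gen (a, b + b', c) - free_gen (a, b, c) - free_gen (a, b', c) |a b b' c. True} \<union>
     {free_gen (a, b, c + c') - free_gen (a, b, c) - free_gen (a, b, c') |a b c c'. True} \<union>
     {free_gen (sA d a, b, c) - free_scale d (free_gen (a, b, c)) |d a b c. True} \<union>
     {free_gen (a, sB d b, c) - free_scale d (free_gen (a, b, c)) |d a b c. True} \<union>
     {free_gen (a, b, sC d c) - free_scale d (free_gen (a, b, c)) |d a b c. True}"

definition tensor3_eq ::
  "('k::field \<Rightarrow> 'a::ab_group_add \<Rightarrow> 'a) \<Rightarrow> ('k \<Rightarrow> 'b::ab_group_add \<Rightarrow> 'b)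
    \<Rightarrow> ('k \<Rightarrow> 'c::ab_group_add \<Rightarrow> 'c)
    \<Rightarrow> ('a \<times> 'b \<times> 'c) list \<Rightarrow> ('a \<times> 'b \<times> 'c) list \<Rightarrow> bool" where
  "tensor3_eq sA sB sC s t \<longleftrightarrow>
     (\<Sum>p\<leftarrow>s. free_gen p) - (\<Sum>p\<leftarrow>t. free_gen p)
       \<in> module.span free_scale (tensor3_relators sA sB sC)"

lemma lookup_free_scale:
  "Poly_Mapping.lookup (free_scale c u) i = c * Poly_Mapping.lookup u i"
  by (simp add: free_scale_def Poly_Mapping.map.rep_eq when_def)

lemma vector_space_free_scale: "vector_space (free_scale :: 'k::field \<Rightarrow> ('x \<Rightarrow>\<^sub>0 'k) \<Rightarrow> _)"
  by unfold_locales
    (auto intro!: poly_mapping_eqI simp: lookup_free_scale lookup_add algebra_simps)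


section \<open>Hopf algebras\<close>

text \<open>
  The value \<open>comul h\<close> is a list \<open>[(h\<^sub>1, h\<^sub>2), \<dots>]\<close> representing the tensor \<open>\<Delta>(h)\<close>, and a Sweedler
  expression \<open>F h\<^sub>1 h\<^sub>2\<close> is written \<open>\<Sum>(h1, h2)\<leftarrow>comul h. F h1 h2\<close>. For bilinear \<open>F\<close> the value
  depends only on the tensor, not on the chosen representative. All axioms on \<open>comul\<close> are
  required only up to equality of tensors.
\<close>

locale hopf_algebra = k_algebra scale
  for scale :: "'k::field \<Rightarrow> 'a::{ring,monoid_mult} \<Rightarrow> 'a" +
  fixes comul :: "'a \<Rightarrow> ('a \<times> 'a) list"
    and counit :: "'a \<Rightarrow> 'k"
    and antipode :: "'a \<Rightarrow> 'a"
  assumes comul_add: "tensor_eq scale scale (comul (a + b)) (comul a @ comul b)"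
    and comul_scale:
      "tensor_eq scale scale (comul (scale c a)) [(scale c a1, a2). (a1, a2) \<leftarrow> comul a]"
    and coassoc:
      "tensor3_eq scale scale scale
         [(a11, a12, a2). (a1, a2) \<leftarrow> comul a, (a11, a12) \<leftarrow> comul a1]
         [(a1, a21, a22). (a1, a2) \<leftarrow> comul a, (a21, a22) \<leftarrow> comul a2]"
    and counit_left: "(\<Sum>(a1, a2)\<leftarrow>comul a. scale (counit a1) a2) = a"
    and counit_right: "(\<Sum>(a1, a2)\<leftarrow>comul a. scale (counit a2) a1) = a"
    and comul_one: "tensor_eq scale scale (comul 1) [(1, 1)]"
    and comul_mult:
      "tensor_eq scale scale (comul (a * b))
         [(a1 * b1, a2 * b2). (a1, a2) \<leftarrow> comul a, (b1, b2) \<leftarrow> comul b]"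
    and counit_hom: "algebra_hom scale (*) counit"
    and antipode_linear: "Vector_Spaces.linear scale scale antipode"
    and antipode_left: "(\<Sum>(a1, a2)\<leftarrow>comul a. antipode a1 * a2) = scale (counit a) 1"
    and antipode_right: "(\<Sum>(a1, a2)\<leftarrow>comul a. a1 * antipode a2) = scale (counit a) 1"
begin

definition grouplikes :: "'a set" where
  "grouplikes = {g. tensor_eq scale scale (comul g) [(g, g)] \<and> counit g = 1}"

end

definition hopf_algebra_hom ::
  "('k::field \<Rightarrow> 'a::{ring,monoid_mult} \<Rightarrow> 'a) \<Rightarrow> ('a \<Rightarrow> ('a \<times> 'a) list) \<Rightarrow> ('a \<Rightarrow> 'k) \<Rightarrow> ('a \<Rightarrow> 'a)
    \<Rightarrow> ('k \<Rightarrow> 'b::{ring,monoid_mult} \<Rightarrow> 'b) \<Rightarrow> ('b \<Rightarrow> ('b \<times> 'b) list) \<Rightarrow> ('b \<Rightarrow> 'k) \<Rightarrow> ('b \<Rightarrow> 'b)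
    \<Rightarrow> ('a \<Rightarrow> 'b) \<Rightarrow> bool" where
  "hopf_algebra_hom sA comulA counitA SA sB comulB counitB SB f \<longleftrightarrow>
     algebra_hom sA sB f \<and>
     (\<forall>a. tensor_eq sB sB (comulB (f a)) [(f a1, f a2). (a1, a2) \<leftarrow> comulA a]) \<and>
     (\<forall>a. counitB (f a) = counitA a) \<and>
     (\<forall>a. SB (f a) = f (SA a))"


section \<open>Hopf-Ore extensions\<close>

definition ore_sum ::
  "('a::{ring,monoid_mult} \<Rightarrow> 'h::{ring,monoid_mult}) \<Rightarrow> 'h \<Rightarrow> (nat \<Rightarrow>\<^sub>0 'a) \<Rightarrow> 'h" where
  "ore_sum \<iota> x c = (\<Sum>i\<in>Poly_Mapping.keys c. x ^ i * \<iota> (Poly_Mapping.lookup c i))"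

text \<open>
  \<open>H\<close> (with structure maps \<open>scaleH\<close>, \<dots>) is the Hopf-Ore extension \<open>A[x,\<sigma>]\<close>, where \<open>\<iota>\<close> is the
  inclusion of \<open>A\<close>. The commutation rule and the normal form determine the algebra \<open>H\<close> up to
  isomorphism.
\<close>

locale hopf_ore_extension =
  A: hopf_algebra scaleA comulA counitA antipodeA +
  H: hopf_algebra scaleH comulH counitH antipodeH
  for scaleA :: "'k::field \<Rightarrow> 'a::{ring,monoid_mult} \<Rightarrow> 'a"
    and comulA counitA antipodeA
    and scaleH :: "'k \<Rightarrow> 'h::{ring,monoid_mult} \<Rightarrow> 'h"
    and comulH counitH antipodeH +
  fixes \<iota> :: "'a \<Rightarrow> 'h"
    and x :: 'h
    and g :: 'a
    and \<chi> :: "'a \<Rightarrow> 'k"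
    and \<sigma> :: "'a \<Rightarrow> 'a"
  assumes g_grouplike: "g \<in> A.grouplikes"
    and \<chi>_character: "algebra_hom scaleA (*) \<chi>"
    and \<sigma>_hom: "algebra_hom scaleA scaleA \<sigma>"
    and \<sigma>_bij: "bij \<sigma>"
    and \<sigma>_left: "\<sigma> a = (\<Sum>(a1, a2)\<leftarrow>comulA a. scaleA (\<chi> a1) a2)"
    and \<sigma>_right: "\<sigma> a = (\<Sum>(a1, a2)\<leftarrow>comulA a. scaleA (\<chi> a2) (g * a1 * mult_inverse g))"
    and \<iota>_hom:
      "hopf_algebra_hom scaleA comulA counitA antipodeA scaleH comulH counitH antipodeH \<iota>"
    and x_commute: "x * \<iota> a = \<iota> (\<sigma> a) * x"
    and normal_form: "\<exists>!c. ore_sum \<iota> x c = y"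
    and comul_x: "tensor_eq scaleH scaleH (comulH x) [(x, 1), (\<iota> g, x)]"

text \<open>The coefficients \<open>a\<^sub>i\<close> of \<open>y = \<Sum>\<^sub>i x\<^sup>i a\<^sub>i\<close>:\<close>

definition ore_coeffs ::
  "('a::{ring,monoid_mult} \<Rightarrow> 'h::{ring,monoid_mult}) \<Rightarrow> 'h \<Rightarrow> 'h \<Rightarrow> (nat \<Rightarrow>\<^sub>0 'a)" where
  "ore_coeffs \<iota> x y = (THE c. ore_sum \<iota> x c = y)"


section \<open>Partial actions and the extension to a Hopf-Ore extension\<close>

definition partial_action ::
  "('k::field \<Rightarrow> 'h::{ring,monoid_mult} \<Rightarrow> 'h) \<Rightarrow> ('h \<Rightarrow> ('h \<times> 'h) list)
    \<Rightarrow> ('k \<Rightarrow> 'r::{ring,monoid_mult} \<Rightarrow> 'r) \<Rightarrow> ('h \<Rightarrow> 'r \<Rightarrow> 'r) \<Rightarrow> bool" where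
  "partial_action sH comulH sR act \<longleftrightarrow>
     bilinear_map sH sR sR act \<and>
     (\<forall>r. act 1 r = r) \<and>
     (\<forall>h r s. act h (r * s) = (\<Sum>(h1, h2)\<leftarrow>comulH h. act h1 r * act h2 s)) \<and>
     (\<forall>h k r. act h (act k r) = (\<Sum>(h1, h2)\<leftarrow>comulH h. act h1 1 * act (h2 * k) r))"

text \<open>
  In the recursion for \<open>n \<ge> 1\<close> and \<open>m = 0\<close> the second summand vanishes, as its lower index
  is negative.
\<close>

fun qbinom :: "'k::field \<Rightarrow> nat \<Rightarrow> nat \<Rightarrow> 'k" where
  "qbinom q 0 0 = 1"
| "qbinom q 0 (Suc m) = 0"
| "qbinom q (Suc n) 0 = qbinom q n 0"
| "qbinom q (Suc n) (Suc m) =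
     (if m \<le> n then qbinom q n (Suc m) + q ^ (n - m) * qbinom q n m else 0)"

definition ext_monomial ::
  "'a::{ring,monoid_mult} \<Rightarrow> 'k::field \<Rightarrow> ('k \<Rightarrow> 'r::{ring,monoid_mult} \<Rightarrow> 'r)
    \<Rightarrow> ('a \<Rightarrow> 'r \<Rightarrow> 'r) \<Rightarrow> 'r \<Rightarrow> nat \<Rightarrow> 'a \<Rightarrow> 'r \<Rightarrow> 'r" where
  "ext_monomial g q sR act w j a r =
     (\<Sum>k=0..j. sR ((- 1) ^ k * q powi (- int (k * (k - 1) div 2)) * qbinom (inverse q) j k)
                  (w ^ (j - k) * act (g ^ k * a) r * w ^ k))"

definition ext_action ::
  "('a::{ring,monoid_mult} \<Rightarrow> 'h::{ring,monoid_mult}) \<Rightarrow> 'h \<Rightarrow> 'a \<Rightarrow> ('a \<Rightarrow> 'k::field)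
    \<Rightarrow> ('k \<Rightarrow> 'r::{ring,monoid_mult} \<Rightarrow> 'r) \<Rightarrow> ('a \<Rightarrow> 'r \<Rightarrow> 'r) \<Rightarrow> 'r \<Rightarrow> 'h \<Rightarrow> 'r \<Rightarrow> 'r" where
  "ext_action \<iota> x g \<chi> sR act w y r =
     (\<Sum>j\<in>Poly_Mapping.keys (ore_coeffs \<iota> x y).
        ext_monomial g (\<chi> g) sR act w j (Poly_Mapping.lookup (ore_coeffs \<iota> x y) j) r)"

text \<open>
  \<open>ext_action\<close> is the unique map \<open>H \<otimes> R \<rightarrow> R\<close> that is given by \<open>ext_monomial\<close> on the elements
  \<open>x\<^sup>j a\<close>, and it extends the action of \<open>A\<close>.
\<close>

context hopf_ore_extension
begin

lemma \<iota>_linear: "Vector_Spaces.linear scaleA scaleH \<iota>"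
  using \<iota>_hom by (simp add: hopf_algebra_hom_def algebra_hom_def)

lemma \<iota>_0: "\<iota> 0 = 0"
  using \<iota>_linear by (rule module_hom.zero[OF module_hom_iff_linear[THEN iffD2]])

lemma \<iota>_add: "\<iota> (a + b) = \<iota> a + \<iota> b"
  using \<iota>_linear by (rule module_hom.add[OF module_hom_iff_linear[THEN iffD2]])

lemma \<iota>_scale: "\<iota> (scaleA c a) = scaleH c (\<iota> a)"
  using \<iota>_linear by (rule module_hom.scale[OF module_hom_iff_linear[THEN iffD2]])

lemma ore_sum_superset:
  assumes "finite S" "Poly_Mapping.keys c \<subseteq> S"
  shows "ore_sum \<iota> x c = (\<Sum>i\<in>S. x ^ i * \<iota> (Poly_Mapping.lookup c i))"
  unfolding ore_sum_def using assms
  by (intro sum.mono_neutral_left) (auto simp: in_keys_iff \<iota>_0)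

lemma ore_sum_coeffs: "ore_sum \<iota> x (ore_coeffs \<iota> x y) = y"
  unfolding ore_coeffs_def by (rule theI'[OF normal_form])

lemma ore_coeffs_eqI: "ore_sum \<iota> x c = y \<Longrightarrow> ore_coeffs \<iota> x y = c"
  using normal_form ore_sum_coeffs by blast

lemma ore_coeffs_add: "ore_coeffs \<iota> x (y + z) = ore_coeffs \<iota> x y + ore_coeffs \<iota> x z"
proof (rule ore_coeffs_eqI)
  let ?c = "ore_coeffs \<iota> x y" and ?d = "ore_coeffs \<iota> x z"
  let ?S = "Poly_Mapping.keys ?c \<union> Poly_Mapping.keys ?d"
  have "ore_sum \<iota> x (?c + ?d) = ore_sum \<iota> x ?c + ore_sum \<iota> x ?d"
    by (subst (1 2 3) ore_sum_superset[where S = ?S])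
      (auto simp: lookup_add \<iota>_add distrib_left sum.distrib dest: subsetD[OF Poly_Mapping.keys_add])
  then show "ore_sum \<iota> x (?c + ?d) = y + z"
    by (simp add: ore_sum_coeffs)
qed

lemma lookup_ore_coeffs_scale:
  "Poly_Mapping.lookup (ore_coeffs \<iota> x (scaleH c y)) i
     = scaleA c (Poly_Mapping.lookup (ore_coeffs \<iota> x y) i)"
proof -
  let ?d = "ore_coeffs \<iota> x y"
  let ?e = "Poly_Mapping.map (scaleA c) ?d"
  have look: "Poly_Mapping.lookup ?e i = scaleA c (Poly_Mapping.lookup ?d i)" for i
    by (simp add: Poly_Mapping.map.rep_eq when_def)
  have "ore_sum \<iota> x ?e
      = (\<Sum>i\<in>Poly_Mapping.keys ?d. x ^ i * \<iota> (Poly_Mapping.lookup ?e i))"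
    by (rule ore_sum_superset) (auto simp: in_keys_iff look)
  also have "\<dots> = scaleH c (ore_sum \<iota> x ?d)"
    by (simp add: look \<iota>_scale H.scale_mult_right ore_sum_def H.scale_sum_right)
  finally have "ore_coeffs \<iota> x (scaleH c y) = ?e"
    by (intro ore_coeffs_eqI) (simp add: ore_sum_coeffs)
  then show ?thesis by (simp add: look)
qed

lemma ore_coeffs_monomial: "ore_coeffs \<iota> x (x ^ j * \<iota> a) = Poly_Mapping.single j a"
  by (rule ore_coeffs_eqI) (simp add: ore_sum_superset[where S = "{j}"])

context
  fixes scaleR :: "'k \<Rightarrow> 'r::{ring,monoid_mult} \<Rightarrow> 'r" and act :: "'a \<Rightarrow> 'r \<Rightarrow> 'r" and w :: 'r
  assumes R: "k_algebra scaleR" and act: "bilinear_map scaleA scaleR scaleR act"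
begin

interpretation R: k_algebra scaleR by (rule R)

lemma act_linear_left: "Vector_Spaces.linear scaleA scaleR (\<lambda>a. act a r)"
  and act_linear_right: "Vector_Spaces.linear scaleR scaleR (act a)"
  using act by (auto simp: bilinear_map_def)

lemmas act_left =
  module_hom.add[OF module_hom_iff_linear[THEN iffD2], OF act_linear_left]
  module_hom.scale[OF module_hom_iff_linear[THEN iffD2], OF act_linear_left]
  module_hom.zero[OF module_hom_iff_linear[THEN iffD2], OF act_linear_left]

lemmas act_right =
  module_hom.add[OF module_hom_iff_linear[THEN iffD2], OF act_linear_right]
  module_hom.scale[OF module_hom_iff_linear[THEN iffD2], OF act_linear_right]

lemma ext_monomial_left:
  "ext_monomial g q scaleR act w j (a + b) r
     = ext_monomial g q scaleR act w j a r + ext_monomial g q scaleR act w j b r"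
  "ext_monomial g q scaleR act w j (scaleA c a) r = scaleR c (ext_monomial g q scaleR act w j a r)"
  "ext_monomial g q scaleR act w j 0 r = 0"
  by (simp_all add: ext_monomial_def distrib_left distrib_right act_left sum.distrib
      R.scale_right_distrib A.scale_mult_right R.scale_mult_left R.scale_mult_right
      R.scale_sum_right mult.commute mult.left_commute)

lemma ext_monomial_right:
  "ext_monomial g q scaleR act w j a (r + s)
     = ext_monomial g q scaleR act w j a r + ext_monomial g q scaleR act w j a s"
  "ext_monomial g q scaleR act w j a (scaleR c r) = scaleR c (ext_monomial g q scaleR act w j a r)"
  by (simp_all add: ext_monomial_def distrib_left distrib_right act_right sum.distrib
      R.scale_right_distrib R.scale_mult_left R.scale_mult_right
      R.scale_sum_right mult.commute mult.left_commute)

lemma ext_action_superset: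
  assumes "finite S" "Poly_Mapping.keys (ore_coeffs \<iota> x y) \<subseteq> S"
  shows "ext_action \<iota> x g \<chi> scaleR act w y r =
    (\<Sum>j\<in>S. ext_monomial g (\<chi> g) scaleR act w j (Poly_Mapping.lookup (ore_coeffs \<iota> x y) j) r)"
  unfolding ext_action_def using assms
  by (intro sum.mono_neutral_left) (auto simp: in_keys_iff ext_monomial_left)

lemma ext_action_monomial:
  "ext_action \<iota> x g \<chi> scaleR act w (x ^ j * \<iota> a) r =
     (\<Sum>k=0..j. scaleR ((- 1) ^ k * \<chi> g powi (- int (k * (k - 1) div 2)) * qbinom (inverse (\<chi> g)) j k)
                  (w ^ (j - k) * act (g ^ k * a) r * w ^ k))"
  by (subst ext_action_superset[where S = "{j}"])
    (simp_all add: ore_coeffs_monomial ext_monomial_def)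

lemma ext_action_extends: "ext_action \<iota> x g \<chi> scaleR act w (\<iota> a) r = act a r"
  using ext_action_monomial[of 0 a r] by simp

lemma ext_action_bilinear:
  "bilinear_map scaleH scaleR scaleR (ext_action \<iota> x g \<chi> scaleR act w)"
proof -
  let ?f = "ext_action \<iota> x g \<chi> scaleR act w"
  have addl: "?f (y + z) r = ?f y r + ?f z r" for y z r
    by (subst (1 2 3) ext_action_superset[where S =
          "Poly_Mapping.keys (ore_coeffs \<iota> x y) \<union> Poly_Mapping.keys (ore_coeffs \<iota> x z)"])
      (auto simp: ore_coeffs_add lookup_add ext_monomial_left sum.distrib
        dest: subsetD[OF Poly_Mapping.keys_add])
  have scalel: "?f (scaleH c y) r = scaleR c (?f y r)" for c y r
    by (subst (1 2) ext_action_superset[where S = "Poly_Mapping.keys (ore_coeffs \<iota> x y)"])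
      (auto simp: lookup_ore_coeffs_scale ext_monomial_left in_keys_iff R.scale_sum_right)
  have addr: "?f y (r + s) = ?f y r + ?f y s" for y r s
    by (simp add: ext_action_def ext_monomial_right sum.distrib)
  have scaler: "?f y (scaleR c r) = scaleR c (?f y r)" for c y r
    by (simp add: ext_action_def ext_monomial_right R.scale_sum_right)
  show ?thesis
    unfolding bilinear_map_def module_hom_iff_linear[symmetric]
    by (auto intro!: module_hom.intro module_hom_axioms.intro
        simp: addl scalel addr scaler H.module_axioms R.module_axioms)
qed

lemma ext_action_unique:
  assumes f: "bilinear_map scaleH scaleR scaleR f"
    and mono: "\<And>j a r. f (x ^ j * \<iota> a) r = ext_monomial g (\<chi> g) scaleR act w j a r"
  shows "f = ext_action \<iota> x g \<chi> scaleR act w"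
proof (intro ext)
  fix y r
  let ?c = "ore_coeffs \<iota> x y"
  have "Vector_Spaces.linear scaleH scaleR (\<lambda>y. f y r)"
    using f by (auto simp: bilinear_map_def)
  then have "f (ore_sum \<iota> x ?c) r
      = (\<Sum>i\<in>Poly_Mapping.keys ?c. f (x ^ i * \<iota> (Poly_Mapping.lookup ?c i)) r)"
    unfolding ore_sum_def
    by (rule module_hom.sum[OF module_hom_iff_linear[THEN iffD2]])
  then show "f y r = ext_action \<iota> x g \<chi> scaleR act w y r"
    by (simp add: ore_sum_coeffs mono ext_action_def)
qed

end

end

end

theory Submission
  imports Defs
begin

text \<open>
  The closed formula for \<open>x\<^sup>j a \<cdot> r\<close> is the solution of the recursion
  \<open>x h \<cdot> r = w (h \<cdot> r) - (g h \<cdot> r) w\<close>, valid for every \<open>h\<close> in the extension: for \<open>h = x\<^sup>j a\<close> the rule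
  \<open>g x = q\<^sup>-\<^sup>1 x g\<close> gives \<open>g h = q\<^sup>-\<^sup>j x\<^sup>j g a\<close>, and the recursion becomes Pascal's rule for
  the \<open>q\<close>-binomial coefficients (\<open>ext_monomial_Suc\<close>, \<open>ext_skew\<close>).

  Call a linear map \<open>D\<close> on the extension skew if \<open>D (x h) = w D(h) - D (g h) w\<close>. If \<open>D\<close>, \<open>E\<close> and \<open>F\<close> are
  skew, the identity \<open>D(h) = \<Sum> E(h\<^sub>1) F(h\<^sub>2)\<close> passes from \<open>h\<close> and \<open>g h\<close> to \<open>x h\<close>, because
  \<open>\<Delta>(x) = x \<otimes> 1 + g \<otimes> x\<close> makes the mixed terms cancel; so it holds on all \<open>x\<^sup>j a\<close> once it holds
  on \<open>A\<close> (\<open>skew_product\<close>). The three identities to be proved are instances of this: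
  \<open>h \<mapsto> h \<cdot> (r s)\<close> against \<open>h \<mapsto> h \<cdot> r\<close> and \<open>h \<mapsto> h \<cdot> s\<close>, and \<open>h \<mapsto> h \<cdot> (k \<cdot> r)\<close> against \<open>h \<mapsto> h \<cdot> 1\<close> and
  \<open>h \<mapsto> h k \<cdot> r\<close>, in either order. On \<open>A\<close> the first is an axiom of partial actions, and the other two
  are the respective hypotheses.
\<close>

section \<open>Sweedler sums\<close>

lemma linear_iff_add_scale:
  "Vector_Spaces.linear s1 s2 f \<longleftrightarrow> vector_space s1 \<and> vector_space s2 \<and>
     (\<forall>x y. f (x + y) = f x + f y) \<and> (\<forall>c x. f (s1 c x) = s2 c (f x))"
  by (auto simp: module_hom_iff_linear[symmetric] module_hom_iff module_iff_vector_space)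

text \<open>
  A bilinear map factors through the tensor product: it extends linearly to the free space on
  pairs, and the extension kills the relators.
\<close>

lemma tensor_eq_sum_list:
  fixes sA :: "'k::field \<Rightarrow> 'a::ab_group_add \<Rightarrow> 'a" and sB :: "'k \<Rightarrow> 'b::ab_group_add \<Rightarrow> 'b"
    and sC :: "'k \<Rightarrow> 'c::ab_group_add \<Rightarrow> 'c"
  assumes \<beta>: "bilinear_map sA sB sC \<beta>" and st: "tensor_eq sA sB s t"
  shows "(\<Sum>(a, b)\<leftarrow>s. \<beta> a b) = (\<Sum>(a, b)\<leftarrow>t. \<beta> a b)"
proof -
  interpret C: vector_space sC
    using \<beta> by (auto simp: bilinear_map_def linear_iff_add_scale)
  interpret free: vector_space "free_scale :: 'k \<Rightarrow> (('a \<times> 'b) \<Rightarrow>\<^sub>0 'k) \<Rightarrow> _"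
    by (rule vector_space_free_scale)
  have bil: "\<beta> (a + a') b = \<beta> a b + \<beta> a' b" "\<beta> (sA c a) b = sC c (\<beta> a b)"
    "\<beta> a (b + b') = \<beta> a b + \<beta> a b'" "\<beta> a (sB c b) = sC c (\<beta> a b)" for a a' b b' c
    using \<beta> by (auto simp: bilinear_map_def linear_iff_add_scale)
  define L where "L u = (\<Sum>p\<in>Poly_Mapping.keys u. sC (Poly_Mapping.lookup u p) (case_prod \<beta> p))"
    for u :: "('a \<times> 'b) \<Rightarrow>\<^sub>0 'k"
  have L_superset: "L u = (\<Sum>p\<in>S. sC (Poly_Mapping.lookup u p) (case_prod \<beta> p))"
    if "finite S" "Poly_Mapping.keys u \<subseteq> S" for u S
    unfolding L_def using that by (intro sum.mono_neutral_left) (auto simp: in_keys_iff)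
  have L_add: "L (u + v) = L u + L v" for u v
    by (subst (1 2 3) L_superset[where S = "Poly_Mapping.keys u \<union> Poly_Mapping.keys v"])
      (auto simp: lookup_add C.scale_left_distrib sum.distrib
        dest: subsetD[OF Poly_Mapping.keys_add])
  have L_scale: "L (free_scale c u) = sC c (L u)" for c u
    by (subst (1 2) L_superset[where S = "Poly_Mapping.keys u"])
      (auto simp: lookup_free_scale C.scale_sum_right in_keys_iff)
  have L_0: "L 0 = 0" by (simp add: L_def)
  have L_diff: "L (u - v) = L u - L v" for u v
    using L_add[of "u - v" v] by simp
  have L_gen: "L (free_gen p) = case_prod \<beta> p" for p
    by (simp add: L_def free_gen_def)
  have L_list: "L (\<Sum>p\<leftarrow>ps. free_gen p) = (\<Sum>(a, b)\<leftarrow>ps. \<beta> a b)" for ps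
    by (induction ps) (simp_all add: L_0 L_add L_gen)
  have "module.span free_scale (tensor_relators sA sB) \<subseteq> {u. L u = 0}"
  proof (rule free.span_minimal)
    show "tensor_relators sA sB \<subseteq> {u. L u = 0}"
      unfolding tensor_relators_def by (auto simp: L_diff L_gen L_scale bil)
    show "free.subspace {u. L u = 0}"
      by (simp add: free.subspace_def L_0 L_add L_scale)
  qed
  then have "L ((\<Sum>p\<leftarrow>s. free_gen p) - (\<Sum>p\<leftarrow>t. free_gen p)) = 0"
    using st by (auto simp: tensor_eq_def)
  then show ?thesis
    by (simp add: L_diff L_list)
qed

lemma bilinear_map_sum_list:
  assumes "vector_space sA" "vector_space sB" "vector_space sC"
    and "\<And>p. p \<in> set ps \<Longrightarrow> bilinear_map sA sB sC (f p)"
  shows "bilinear_map sA sB sC (\<lambda>a b. \<Sum>p\<leftarrow>ps. f p a b)"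
  using assms(4)
proof (induction ps)
  case Nil
  then show ?case
    using assms(1-3)
    by (simp add: bilinear_map_def linear_iff_add_scale module.scale_zero_right module_iff_vector_space)
next
  case (Cons p ps)
  then have "bilinear_map sA sB sC (f p)" "bilinear_map sA sB sC (\<lambda>a b. \<Sum>p\<leftarrow>ps. f p a b)"
    by simp_all
  then show ?case
    by (simp add: bilinear_map_def linear_iff_add_scale vector_space.vector_space_assms(1))
qed

lemma bilinear_map_mult:
  assumes "k_algebra sC" "Vector_Spaces.linear sA sC E" "Vector_Spaces.linear sB sC F"
  shows "bilinear_map sA sB sC (\<lambda>a b. E a * F b)"
  using assms
  by (auto simp: bilinear_map_def linear_iff_add_scale distrib_left distrib_right
      k_algebra.scale_mult_left k_algebra.scale_mult_right)

lemma sum_list_tensor_mult: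
  "(\<Sum>(c1, c2)\<leftarrow>[(a1 * b1, a2 * b2). (a1, a2) \<leftarrow> s, (b1, b2) \<leftarrow> t]. \<beta> c1 c2)
     = (\<Sum>(a1, a2)\<leftarrow>s. \<Sum>(b1, b2)\<leftarrow>t. \<beta> (a1 * b1) (a2 * b2))"
proof (induction s)
  case (Cons p s)
  then show ?case by (cases p) (simp add: case_prod_unfold comp_def)
qed simp

context hopf_algebra
begin

text \<open>
  The inner sum over \<open>\<Delta>(b)\<close> is itself bilinear in the factors of \<open>\<Delta>(a)\<close>. This is what allows
  the list \<open>comul a\<close> in \<open>sweedler_mult\<close> below to be exchanged for any other representative of
  \<open>\<Delta>(a)\<close>, such as \<open>g \<otimes> g\<close> for \<open>a = g\<close>.
\<close>

lemma bilinear_sweedler_mult: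
  assumes "bilinear_map scale scale sC \<beta>"
  shows "bilinear_map scale scale sC (\<lambda>a1 a2. \<Sum>(b1, b2)\<leftarrow>comul b. \<beta> (a1 * b1) (a2 * b2))"
  unfolding case_prod_unfold using assms
  by (intro bilinear_map_sum_list vector_space_axioms)
    (auto simp: bilinear_map_def linear_iff_add_scale distrib_right scale_mult_left)

lemma sweedler_mult:
  assumes "bilinear_map scale scale sC \<beta>"
  shows "(\<Sum>(c1, c2)\<leftarrow>comul (a * b). \<beta> c1 c2)
     = (\<Sum>(a1, a2)\<leftarrow>comul a. \<Sum>(b1, b2)\<leftarrow>comul b. \<beta> (a1 * b1) (a2 * b2))"
  using tensor_eq_sum_list[OF assms comul_mult] by (simp only: sum_list_tensor_mult)

end


section \<open>The twist parameter\<close>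

context hopf_ore_extension
begin

lemma comulA_g: "tensor_eq scaleA scaleA (comulA g) [(g, g)]"
  and counitA_g: "counitA g = 1"
  using g_grouplike by (auto simp: A.grouplikes_def)

text \<open>
  With this, the commutation rule for \<open>x\<close> and \<open>g\<close> is \<open>x g = q g x\<close>.
\<close>

lemma \<sigma>_g: "\<sigma> g = scaleA (\<chi> g) g"
proof -
  have "bilinear_map scaleA scaleA scaleA (\<lambda>a b. scaleA (\<chi> a) b)"
    using \<chi>_character A.vector_space_axioms
    by (auto simp: bilinear_map_def algebra_hom_def linear_iff_add_scale A.scale_left_distrib
        A.scale_right_distrib mult.commute)
  from tensor_eq_sum_list[OF this comulA_g] show ?thesis
    by (simp add: \<sigma>_left)
qed

text \<open>A grouplike is invertible, with inverse its antipode, and characters preserve units.\<close>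

lemma \<chi>_g_nonzero: "\<chi> g \<noteq> 0"
proof -
  have "bilinear_map scaleA scaleA scaleA (\<lambda>a b. antipodeA a * b)"
    using A.antipode_linear A.k_algebra_axioms A.vector_space_axioms
    by (intro bilinear_map_mult) (auto simp: linear_iff_add_scale)
  from tensor_eq_sum_list[OF this comulA_g] have "antipodeA g * g = 1"
    using A.antipode_left[of g] by (simp add: counitA_g)
  then have "\<chi> (antipodeA g) * \<chi> g = 1"
    using \<chi>_character by (metis algebra_hom_def)
  then show ?thesis by auto
qed

lemma \<iota>_mult: "\<iota> (a * b) = \<iota> a * \<iota> b"
  and \<iota>_1: "\<iota> 1 = 1"
  and comul_\<iota>: "tensor_eq scaleH scaleH (comulH (\<iota> a)) [(\<iota> a1, \<iota> a2). (a1, a2) \<leftarrow> comulA a]"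
  using \<iota>_hom by (auto simp: hopf_algebra_hom_def algebra_hom_def)

lemma sweedler_\<iota>:
  assumes \<beta>: "bilinear_map scaleH scaleH sC \<beta>"
  shows "(\<Sum>(h1, h2)\<leftarrow>comulH (\<iota> a). \<beta> h1 h2) = (\<Sum>(a1, a2)\<leftarrow>comulA a. \<beta> (\<iota> a1) (\<iota> a2))"
  using tensor_eq_sum_list[OF \<beta> comul_\<iota>] by (simp add: case_prod_unfold comp_def)

lemma g_x_power: "\<iota> g * x ^ j = scaleH (inverse (\<chi> g) ^ j) (x ^ j * \<iota> g)"
proof (induction j)
  case (Suc j)
  have "x * \<iota> g = scaleH (\<chi> g) (\<iota> g * x)"
    by (simp add: x_commute \<sigma>_g \<iota>_scale H.scale_mult_left)
  then have "\<iota> g * x = scaleH (inverse (\<chi> g)) (x * \<iota> g)"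
    by (simp add: \<chi>_g_nonzero)
  then have "\<iota> g * x ^ Suc j = scaleH (inverse (\<chi> g)) (x * (\<iota> g * x ^ j))"
    by (simp flip: mult.assoc add: H.scale_mult_left)
  then show ?case
    by (simp add: Suc H.scale_mult_right mult.assoc)
qed simp

lemma g_monomial:
  "\<iota> g * (x ^ j * \<iota> a) = scaleH (inverse (\<chi> g) ^ j) (x ^ j * \<iota> (g * a))"
  by (simp add: \<iota>_mult g_x_power H.scale_mult_left flip: mult.assoc)


section \<open>Skew maps on the extension\<close>

lemma sweedler_g_mult:
  assumes \<beta>: "bilinear_map scaleH scaleH sC \<beta>"
  shows "(\<Sum>(c1, c2)\<leftarrow>comulH (\<iota> g * h). \<beta> c1 c2)
     = (\<Sum>(h1, h2)\<leftarrow>comulH h. \<beta> (\<iota> g * h1) (\<iota> g * h2))"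
proof -
  define \<gamma> where "\<gamma> u v = (\<Sum>(h1, h2)\<leftarrow>comulH h. \<beta> (u * h1) (v * h2))" for u v
  have \<gamma>: "bilinear_map scaleH scaleH sC \<gamma>"
    unfolding \<gamma>_def by (rule H.bilinear_sweedler_mult[OF \<beta>])
  then have "bilinear_map scaleA scaleA sC (\<lambda>a b. \<gamma> (\<iota> a) (\<iota> b))"
    using A.vector_space_axioms
    by (simp add: bilinear_map_def linear_iff_add_scale \<iota>_add \<iota>_scale)
  from tensor_eq_sum_list[OF this comulA_g]
  have "(\<Sum>(u, v)\<leftarrow>comulH (\<iota> g). \<gamma> u v) = \<gamma> (\<iota> g) (\<iota> g)"
    by (simp add: sweedler_\<iota>[OF \<gamma>])
  then show ?thesis
    by (simp only: H.sweedler_mult[OF \<beta>] \<gamma>_def)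
qed

lemma sweedler_x_mult:
  assumes \<beta>: "bilinear_map scaleH scaleH sC \<beta>"
  shows "(\<Sum>(c1, c2)\<leftarrow>comulH (x * h). \<beta> c1 c2)
     = (\<Sum>(h1, h2)\<leftarrow>comulH h. \<beta> (x * h1) h2 + \<beta> (\<iota> g * h1) (x * h2))"
  using tensor_eq_sum_list[OF H.bilinear_sweedler_mult[OF \<beta>, of h] comul_x]
  unfolding H.sweedler_mult[OF \<beta>] by (simp add: case_prod_unfold sum_list_addf)

text \<open>
  Skewness isolates the property of \<open>h \<mapsto> h \<cdot> r\<close> that matters: it determines a map from its values on
  \<open>A\<close>, and it applies alike to \<open>h \<mapsto> h \<cdot> (r s)\<close>, \<open>h \<mapsto> h \<cdot> (k \<cdot> r)\<close> and \<open>h \<mapsto> h k \<cdot> r\<close>.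
\<close>

definition skew_map :: "('k \<Rightarrow> 'r::{ring,monoid_mult} \<Rightarrow> 'r) \<Rightarrow> 'r \<Rightarrow> ('h \<Rightarrow> 'r) \<Rightarrow> bool" where
  "skew_map sR w D \<longleftrightarrow> Vector_Spaces.linear scaleH sR D \<and>
     (\<forall>h. D (x * h) = w * D h - D (\<iota> g * h) * w)"

text \<open>
  Left multiplication by \<open>x\<close> and \<open>g\<close> commutes with right multiplication by \<open>k\<close>. The case of interest
  is \<open>k = x\<^sup>i b\<close>.
\<close>

lemma skew_map_right_translate:
  assumes "skew_map sR w D"
  shows "skew_map sR w (\<lambda>h. D (h * k))"
  using assms
  by (auto simp: skew_map_def linear_iff_add_scale distrib_right H.scale_mult_left mult.assoc)

text \<open>
  As \<open>\<Delta>(x h) = x h\<^sub>1 \<otimes> h\<^sub>2 + g h\<^sub>1 \<otimes> x h\<^sub>2\<close>, the skew rule turns \<open>\<Sum> E((x h)\<^sub>1) F((x h)\<^sub>2)\<close> into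
  \<open>w E(h\<^sub>1) F(h\<^sub>2) - E(g h\<^sub>1) w F(h\<^sub>2) + E(g h\<^sub>1) w F(h\<^sub>2) - E(g h\<^sub>1) F(g h\<^sub>2) w\<close>. The two middle terms
  cancel, and what remains is \<open>w D(h) - D(g h) w = D(x h)\<close>, provided that the identity is known for
  \<open>h\<close> and \<open>g h\<close>. For \<open>h = x\<^sup>j a\<close> the element \<open>g h\<close> is a multiple of \<open>x\<^sup>j (g a)\<close>, which is why the
  induction on \<open>j\<close> must keep \<open>a\<close> arbitrary.
\<close>

lemma skew_product:
  assumes R: "k_algebra sR"
    and D: "skew_map sR w D" and E: "skew_map sR w E" and F: "skew_map sR w F"
    and base: "\<And>a. D (\<iota> a) = (\<Sum>(a1, a2)\<leftarrow>comulA a. E (\<iota> a1) * F (\<iota> a2))"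
  shows "D (x ^ j * \<iota> a) = (\<Sum>(h1, h2)\<leftarrow>comulH (x ^ j * \<iota> a). E h1 * F h2)"
proof -
  have lin: "bilinear_map scaleH scaleH sR (\<lambda>h1 h2. E h1 * F h2)"
    using R E F by (intro bilinear_map_mult) (auto simp: skew_map_def)
  show ?thesis
  proof (induction j arbitrary: a)
    case 0
    then show ?case by (simp add: base sweedler_\<iota>[OF lin])
  next
    case (Suc j)
    let ?h = "x ^ j * \<iota> a"
    have scale: "(\<Sum>(h1, h2)\<leftarrow>comulH (scaleH c h). E h1 * F h2)
        = sR c (\<Sum>(h1, h2)\<leftarrow>comulH h. E h1 * F h2)" for c h
    proof -
      interpret R: k_algebra sR by (rule R)
      have pull: "(\<Sum>(h1, h2)\<leftarrow>ps. sR c (E h1 * F h2))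
          = sR c (\<Sum>(h1, h2)\<leftarrow>ps. E h1 * F h2)" for ps
        by (induction ps) (auto simp: R.scale_right_distrib)
      have "(\<Sum>(h1, h2)\<leftarrow>comulH (scaleH c h). E h1 * F h2)
          = (\<Sum>(h1, h2)\<leftarrow>comulH h. sR c (E h1 * F h2))"
        using tensor_eq_sum_list[OF lin H.comul_scale[of c h]] E
        by (simp add: case_prod_unfold comp_def skew_map_def linear_iff_add_scale R.scale_mult_left)
      then show ?thesis by (simp only: pull)
    qed
    have Dgh: "D (\<iota> g * ?h) = (\<Sum>(h1, h2)\<leftarrow>comulH ?h. E (\<iota> g * h1) * F (\<iota> g * h2))"
    proof -
      have "D (\<iota> g * ?h) = (\<Sum>(h1, h2)\<leftarrow>comulH (\<iota> g * ?h). E h1 * F h2)"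
        using D by (simp add: g_monomial scale Suc skew_map_def linear_iff_add_scale)
      then show ?thesis by (simp add: sweedler_g_mult[OF lin])
    qed
    have "(\<Sum>(h1, h2)\<leftarrow>comulH (x * ?h). E h1 * F h2)
        = (\<Sum>(h1, h2)\<leftarrow>comulH ?h. w * (E h1 * F h2) - E (\<iota> g * h1) * F (\<iota> g * h2) * w)"
      unfolding sweedler_x_mult[OF lin]
      using E F by (simp add: skew_map_def left_diff_distrib right_diff_distrib mult.assoc)
    also have "\<dots> = w * (\<Sum>(h1, h2)\<leftarrow>comulH ?h. E h1 * F h2)
        - (\<Sum>(h1, h2)\<leftarrow>comulH ?h. E (\<iota> g * h1) * F (\<iota> g * h2)) * w"
      by (simp add: case_prod_unfold sum_list_subtractf sum_list_const_mult sum_list_mult_const)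
    also have "\<dots> = D (x * ?h)"
      using D by (simp add: skew_map_def Suc Dgh)
    finally show ?case by (simp add: mult.assoc)
  qed
qed

end


section \<open>The extended action is skew\<close>

lemma qbinom_eq_0: "n < m \<Longrightarrow> qbinom q n m = 0"
  by (induction q n m rule: qbinom.induct) auto

definition ext_coeff :: "'k::field \<Rightarrow> nat \<Rightarrow> nat \<Rightarrow> 'k" where
  "ext_coeff q j k = (- 1) ^ k * q powi (- int (k * (k - 1) div 2)) * qbinom (inverse q) j k"

lemma ext_coeff_simps:
  "ext_coeff q (Suc j) 0 = ext_coeff q j 0"
  "j < k \<Longrightarrow> ext_coeff q j k = 0"
  by (simp_all add: ext_coeff_def qbinom_eq_0)

text \<open>
  Pascal's rule. The exponents \<open>k (k + 1) / 2\<close> and \<open>k (k - 1) / 2\<close> differ by \<open>k\<close>, so the quotient of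
  the two powers of \<open>q\<close> is \<open>q\<^sup>-\<^sup>k\<close>. The recursion of the \<open>q\<close>-binomials contributes \<open>j - k\<close> further
  factors \<open>q\<^sup>-\<^sup>1\<close>, and the product \<open>q\<^sup>-\<^sup>j\<close> is independent of \<open>k\<close>. It is the scalar in
  \<open>g x\<^sup>j = q\<^sup>-\<^sup>j x\<^sup>j g\<close>.
\<close>

lemma ext_coeff_Suc_Suc:
  "ext_coeff q (Suc j) (Suc k) = ext_coeff q j (Suc k) - inverse q ^ j * ext_coeff q j k"
proof (cases "k \<le> j")
  case True
  then obtain d where d: "j = k + d"
    using le_Suc_ex by blast
  \<comment> \<open>As \<open>div\<close> truncates, the difference of the two exponents has to be computed in \<open>nat\<close>.\<close>
  have "Suc k * k div 2 = k * (k - 1) div 2 + k"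
    by (cases k) (simp_all add: algebra_simps)
  then have "q powi (- int (Suc k * (Suc k - 1) div 2)) * inverse q ^ (j - k)
      = q powi (- int (k * (k - 1) div 2)) * inverse q ^ j"
    by (simp only: d power_int_minus power_int_of_nat power_inverse power_add diff_Suc_1
        inverse_mult_distrib add_diff_cancel_left' mult.assoc)
  then show ?thesis
    using True by (simp add: ext_coeff_def algebra_simps)
next
  case False
  then show ?thesis by (simp add: ext_coeff_simps)
qed

context hopf_ore_extension
begin

context
  fixes sR :: "'k \<Rightarrow> 'r::{ring,monoid_mult} \<Rightarrow> 'r" and act :: "'a \<Rightarrow> 'r \<Rightarrow> 'r" and w :: 'r
  assumes R: "k_algebra sR" and act: "bilinear_map scaleA sR sR act"
begin

interpretation R: k_algebra sR by (rule R)

abbreviation (input) "ext \<equiv> ext_action \<iota> x g \<chi> sR act w"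

text \<open>
  This is the skew rule for \<open>h = x\<^sup>j a\<close>, with \<open>g h\<close> brought to normal form. In Pascal's rule
  (\<open>ext_coeff_Suc_Suc\<close>) the first term keeps \<open>g\<^sup>k a\<close> and gives \<open>w (h \<cdot> r)\<close>; the second acts through \<open>g\<^sup>k\<^sup>+\<^sup>1 a = g\<^sup>k (g a)\<close> and
  has one more \<open>w\<close> on the right.
\<close>

lemma ext_monomial_Suc:
  "ext (x ^ Suc j * \<iota> a) r
     = w * ext (x ^ j * \<iota> a) r - sR (inverse (\<chi> g) ^ j) (ext (x ^ j * \<iota> (g * a)) r) * w"
proof -
  define c where "c = ext_coeff (\<chi> g)"
  define p where "p = inverse (\<chi> g) ^ j"
  define t where "t i k = w ^ (i - k) * act (g ^ k * a) r * w ^ k" for i k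
  have mono: "ext (x ^ i * \<iota> b) r
      = (\<Sum>k=0..i. sR (c i k) (w ^ (i - k) * act (g ^ k * b) r * w ^ k))" for i b
    by (simp add: ext_action_monomial[OF R act] c_def ext_coeff_def)
  have "ext (x ^ Suc j * \<iota> a) r
      = sR (c j 0) (t (Suc j) 0) + (\<Sum>k=0..j. sR (c (Suc j) (Suc k)) (t (Suc j) (Suc k)))"
    unfolding mono t_def[symmetric]
    by (subst sum.atLeast0_atMost_Suc_shift) (simp add: c_def ext_coeff_simps comp_def)
  also have "\<dots> = sR (c j 0) (t (Suc j) 0) + (\<Sum>k=0..j. sR (c j (Suc k)) (t (Suc j) (Suc k)))
      - (\<Sum>k=0..j. sR (p * c j k) (t (Suc j) (Suc k)))"
    by (simp add: c_def p_def ext_coeff_Suc_Suc R.scale_left_diff_distrib sum_subtractf)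
  also have "sR (c j 0) (t (Suc j) 0) + (\<Sum>k=0..j. sR (c j (Suc k)) (t (Suc j) (Suc k)))
      = (\<Sum>k=0..Suc j. sR (c j k) (t (Suc j) k))"
    by (subst sum.atLeast0_atMost_Suc_shift) (simp add: comp_def)
  \<comment> \<open>the coefficient for \<open>k = j + 1\<close> vanishes\<close>
  also have "\<dots> = (\<Sum>k=0..j. sR (c j k) (t (Suc j) k))"
    by (simp add: c_def ext_coeff_simps)
  also have "\<dots> = w * ext (x ^ j * \<iota> a) r"
    unfolding mono sum_distrib_left
    by (intro sum.cong) (auto simp: t_def R.scale_mult_right Suc_diff_le mult.assoc)
  also have "(\<Sum>k=0..j. sR (p * c j k) (t (Suc j) (Suc k)))
      = sR p (ext (x ^ j * \<iota> (g * a)) r) * w"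
    unfolding mono R.scale_sum_right sum_distrib_right
    by (intro sum.cong) (auto simp: t_def R.scale_mult_left power_Suc2 mult.assoc simp del: power_Suc)
  finally show ?thesis by (simp add: p_def)
qed

lemma ext_skew: "skew_map sR w (\<lambda>h. ext h r)"
proof -
  have lin: "Vector_Spaces.linear scaleH sR (\<lambda>h. ext h r)"
    using ext_action_bilinear[OF R act] by (simp add: bilinear_map_def)
  then have ext_scale: "ext (scaleH c h) r = sR c (ext h r)" for c h
    by (simp add: linear_iff_add_scale)
  have sum: "ext (\<Sum>i\<in>S. f i) r = (\<Sum>i\<in>S. ext (f i) r)" for f :: "nat \<Rightarrow> 'h" and S
    by (rule module_hom.sum[OF module_hom_iff_linear[THEN iffD2, OF lin]])
  have mono: "ext (x * (x ^ j * \<iota> a)) r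
      = w * ext (x ^ j * \<iota> a) r - ext (\<iota> g * (x ^ j * \<iota> a)) r * w" for j a
    using ext_monomial_Suc[of j a r] by (simp add: g_monomial ext_scale mult.assoc)
  have "ext (x * ore_sum \<iota> x c) r
      = w * ext (ore_sum \<iota> x c) r - ext (\<iota> g * ore_sum \<iota> x c) r * w" for c
    unfolding ore_sum_def sum_distrib_left sum mono sum_distrib_right sum_subtractf ..
  from this[of "ore_coeffs \<iota> x _"] show ?thesis
    by (simp add: skew_map_def lin ore_sum_coeffs)
qed

end

end


section \<open>Extension of the partial action\<close>

theorem theorem3p6:
  fixes scaleA :: "'k::{alg_closed_field,field_char_0} \<Rightarrow> 'a::{ring,monoid_mult} \<Rightarrow> 'a"
    and comulA :: "'a \<Rightarrow> ('a \<times> 'a) list" and counitA :: "'a \<Rightarrow> 'k" and antipodeA :: "'a \<Rightarrow> 'a"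
    and scaleH :: "'k \<Rightarrow> 'h::{ring,monoid_mult} \<Rightarrow> 'h"
    and comulH :: "'h \<Rightarrow> ('h \<times> 'h) list" and counitH :: "'h \<Rightarrow> 'k" and antipodeH :: "'h \<Rightarrow> 'h"
    and \<iota> :: "'a \<Rightarrow> 'h" and x :: 'h and g :: 'a and \<chi> :: "'a \<Rightarrow> 'k" and \<sigma> :: "'a \<Rightarrow> 'a"
    and scaleR :: "'k \<Rightarrow> 'r::{ring,monoid_mult} \<Rightarrow> 'r"
    and act :: "'a \<Rightarrow> 'r \<Rightarrow> 'r" and w :: 'r
    and actH :: "'h \<Rightarrow> 'r \<Rightarrow> 'r" (infixr "\<triangleright>" 75)
  assumes "hopf_ore_extension scaleA comulA counitA antipodeA
             scaleH comulH counitH antipodeH \<iota> x g \<chi> \<sigma>"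
    and "k_algebra scaleR"
    and "partial_action scaleA comulA scaleR act"
    and "act g 1 = 0"
    and "actH = ext_action \<iota> x g \<chi> scaleR act w"
  shows "(\<forall>r. 1 \<triangleright> r = r) \<and>
         (\<forall>a j r s. (x ^ j * \<iota> a) \<triangleright> (r * s)
           = (\<Sum>(h1, h2)\<leftarrow>comulH (x ^ j * \<iota> a). (h1 \<triangleright> r) * (h2 \<triangleright> s))) \<and>
         ((\<forall>a b j r. \<iota> a \<triangleright> ((x ^ j * \<iota> b) \<triangleright> r)
             = (\<Sum>(a1, a2)\<leftarrow>comulA a. (\<iota> a1 \<triangleright> 1) * ((\<iota> a2 * x ^ j * \<iota> b) \<triangleright> r))) \<longrightarrow>
          (\<forall>a b i j r. (x ^ j * \<iota> a) \<triangleright> ((x ^ i * \<iota> b) \<triangleright> r)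
             = (\<Sum>(h1, h2)\<leftarrow>comulH (x ^ j * \<iota> a). (h1 \<triangleright> 1) * ((h2 * x ^ i * \<iota> b) \<triangleright> r)))) \<and>
         ((\<forall>a b j r. \<iota> a \<triangleright> ((x ^ j * \<iota> b) \<triangleright> r)
             = (\<Sum>(a1, a2)\<leftarrow>comulA a. ((\<iota> a1 * x ^ j * \<iota> b) \<triangleright> r) * (\<iota> a2 \<triangleright> 1))) \<longrightarrow>
          (\<forall>a b i j r. (x ^ j * \<iota> a) \<triangleright> ((x ^ i * \<iota> b) \<triangleright> r)
             = (\<Sum>(h1, h2)\<leftarrow>comulH (x ^ j * \<iota> a). ((h1 * x ^ i * \<iota> b) \<triangleright> r) * (h2 \<triangleright> 1))))"
proof -
  interpret hopf_ore_extension scaleA comulA counitA antipodeA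
    scaleH comulH counitH antipodeH \<iota> x g \<chi> \<sigma>
    by (fact assms(1))
  note R = assms(2)
  have act: "bilinear_map scaleA scaleR scaleR act"
    using assms(3) by (simp add: partial_action_def)
  have on_A: "\<iota> a \<triangleright> r = act a r" for a r
    by (simp add: assms(5) ext_action_extends[OF R act])
  have skew: "skew_map scaleR w (\<lambda>h. h \<triangleright> r)" for r
    unfolding assms(5) by (rule ext_skew[OF R act])
  have skew_translate: "skew_map scaleR w (\<lambda>h. (h * x ^ i * \<iota> b) \<triangleright> r)" for i b r
    using skew_map_right_translate[OF skew, of "x ^ i * \<iota> b"] by (simp add: mult.assoc)
  have "1 \<triangleright> r = r" for r
    using on_A[of 1 r] assms(3) by (simp add: \<iota>_1 partial_action_def)
  moreover have "(x ^ j * \<iota> a) \<triangleright> (r * s)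
      = (\<Sum>(h1, h2)\<leftarrow>comulH (x ^ j * \<iota> a). (h1 \<triangleright> r) * (h2 \<triangleright> s))" for a j r s
    by (rule skew_product[OF R skew skew skew])
      (use assms(3) in \<open>simp add: on_A partial_action_def\<close>)
  moreover have "(x ^ j * \<iota> a) \<triangleright> ((x ^ i * \<iota> b) \<triangleright> r)
      = (\<Sum>(h1, h2)\<leftarrow>comulH (x ^ j * \<iota> a). (h1 \<triangleright> 1) * ((h2 * x ^ i * \<iota> b) \<triangleright> r))"
    if "\<forall>a b j r. \<iota> a \<triangleright> ((x ^ j * \<iota> b) \<triangleright> r)
          = (\<Sum>(a1, a2)\<leftarrow>comulA a. (\<iota> a1 \<triangleright> 1) * ((\<iota> a2 * x ^ j * \<iota> b) \<triangleright> r))" for a b i j r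
    by (rule skew_product[OF R skew skew skew_translate]) (simp add: that)
  moreover have "(x ^ j * \<iota> a) \<triangleright> ((x ^ i * \<iota> b) \<triangleright> r)
      = (\<Sum>(h1, h2)\<leftarrow>comulH (x ^ j * \<iota> a). ((h1 * x ^ i * \<iota> b) \<triangleright> r) * (h2 \<triangleright> 1))"
    if "\<forall>a b j r. \<iota> a \<triangleright> ((x ^ j * \<iota> b) \<triangleright> r)
          = (\<Sum>(a1, a2)\<leftarrow>comulA a. ((\<iota> a1 * x ^ j * \<iota> b) \<triangleright> r) * (\<iota> a2 \<triangleright> 1))" for a b i j r
    by (rule skew_product[OF R skew skew_translate skew]) (simp add: that)
  ultimately show ?thesis
    by blast
qed

end
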